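(* Let $p\ge1$ be an integer. The coefficients of each mapping $F\in\mathcal{HC}_p$ satisfy the inequalities $$\sum_{k=1}^{p}\big(|a_{k,j}|+|b_{k,j}|\big)\le\frac1{j^2}$$ for $j=2,3,\ldots$. These inequalities are sharp, i.e. for each $j\ge2$ there is a mapping $F\in\mathcal{HC}_p$ for which equality holds.
   Context: $\mathbb{D}=\{z\in\mathbb{C}:|z|<1\}$. For an integer $p\ge1$, $\mathcal{H}_p$ is the set of polyharmonic mappings $F$ in $\mathbb{D}$ of the form $$F(z)=\sum_{k=1}^{p}|z|^{2(k-1)}\big(h_k(z)+\overline{g_k(z)}\big)=\sum_{k=1}^{p}|z|^{2(k-1)}\sum_{j=1}^{\infty}\big(a_{k,j}z^j+\overline{b_{k,j}}\,\overline{z^j}\big),$$ with $h_k(z)=\sum_{j\ge1}a_{k,j}z^j$, $g_k(z)=\sum_{j\ge1}b_{k,j}z^j$ analytic in $\mathbb{D}$, $a_{1,1}=1$, $|b_{1,1}|<1$; the $a_{k,j},b_{k,j}$ are the coefficients of $F$. $\mathcal{HC}_p$ is the class of $F\in\mathcal{H}_p$ satisfying $$\sum_{k=1}^{p}\sum_{j=2}^{\infty}\big(2(k-1)+j^2\big)\big(|a_{k,j}|+|b_{k,j}|\big)\le 1-|b_{1,1}|-\sum_{k=2}^{p}(2k-1)\big(|a_{k,1}|+|b_{k,1}|\big)$$ and $$0\le |b_{1,1}|+\sum_{k=2}^{p}(2k-1)\big(|a_{k,1}|+|b_{k,1}|\big)<1.$$ *)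

theory Defs
  imports "HOL-Analysis.Analysis"
begin

abbreviation unit_disc :: "complex set" where
  "unit_disc \<equiv> ball 0 1"

text \<open>
  Coefficient families are indexed by \<open>k \<in> {1..p}\<close> and \<open>j \<in> {1..}\<close>; their values at other
  indices are irrelevant, as are the values of \<open>F\<close> outside the unit disc.
\<close>

definition polyharmonic_coeffs ::
  "nat \<Rightarrow> (complex \<Rightarrow> complex) \<Rightarrow> (nat \<Rightarrow> nat \<Rightarrow> complex) \<Rightarrow> (nat \<Rightarrow> nat \<Rightarrow> complex) \<Rightarrow> bool"
where
  "polyharmonic_coeffs p F a b \<longleftrightarrow>
     (\<exists>h g :: nat \<Rightarrow> complex \<Rightarrow> complex.
        (\<forall>k\<in>{1..p}. h k holomorphic_on unit_disc \<and> g k holomorphic_on unit_disc \<and>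
           (\<forall>z\<in>unit_disc. ((\<lambda>j. a k j * z ^ j) has_sum h k z) {1..} \<and>
                         ((\<lambda>j. b k j * z ^ j) has_sum g k z) {1..})) \<and>
        (\<forall>z\<in>unit_disc.
           F z = (\<Sum>k=1..p. of_real (norm z ^ (2 * (k - 1))) * (h k z + cnj (g k z))))) \<and>
     a 1 1 = 1 \<and> norm (b 1 1) < 1"

definition H_class :: "nat \<Rightarrow> (complex \<Rightarrow> complex) set" where
  "H_class p = {F. \<exists>a b. polyharmonic_coeffs p F a b}"

text \<open>
  Summability is required explicitly because \<open>infsum\<close> is \<open>0\<close> on divergent families, whereas
  an inequality bounding a divergent nonnegative series is to be read as false.
\<close>

definition HC_class :: "nat \<Rightarrow> (complex \<Rightarrow> complex) set" where
  "HC_class p = {F \<in> H_class p. \<exists>a b. polyharmonic_coeffs p F a b \<and>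
     (\<forall>k\<in>{1..p}.
        (\<lambda>j. (2 * (real k - 1) + real j ^ 2) * (norm (a k j) + norm (b k j))) summable_on {2..}) \<and>
     (\<Sum>k=1..p. \<Sum>\<^sub>\<infinity>j\<in>{2..}. (2 * (real k - 1) + real j ^ 2) * (norm (a k j) + norm (b k j)))
       \<le> 1 - norm (b 1 1) - (\<Sum>k=2..p. (2 * real k - 1) * (norm (a k 1) + norm (b k 1))) \<and>
     0 \<le> norm (b 1 1) + (\<Sum>k=2..p. (2 * real k - 1) * (norm (a k 1) + norm (b k 1))) \<and>
     norm (b 1 1) + (\<Sum>k=2..p. (2 * real k - 1) * (norm (a k 1) + norm (b k 1))) < 1}"

end

theory Submission
  imports Defs "HOL-Complex_Analysis.Complex_Analysis"
begin

text \<open>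
  The bound is immediate from \<open>j\<^sup>2 \<le> 2 (k - 1) + j\<^sup>2\<close> once the coefficients are known to be
  determined by \<open>F\<close>. For this uniqueness, fix a radius \<open>r < 1\<close>: the difference of two expansions
  restricts on the circle \<open>\<bar>z\<bar> = r\<close> to \<open>P + cnj Q\<close>, where \<open>P = \<Sum>k. r ^ (2 * (k - 1)) * h\<^sub>k\<close> and
  \<open>Q = \<Sum>k. r ^ (2 * (k - 1)) * g\<^sub>k\<close> are holomorphic and vanish at \<open>0\<close>. Then \<open>Re (P + Q)\<close> and
  \<open>Im (P - Q)\<close> vanish on the circle, so \<open>P = Q = 0\<close> inside it by the maximum principle. Thus, for
  fixed \<open>z\<close>, the polynomials in \<open>r\<^sup>2\<close> with coefficients \<open>h\<^sub>k z\<close> and \<open>g\<^sub>k z\<close> vanish for all \<open>r\<close>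
  between \<open>\<bar>z\<bar>\<close> and \<open>1\<close>, whence \<open>h\<^sub>k = g\<^sub>k = 0\<close>. Equality in the bound is attained by
  \<open>z + z\<^sup>j / j\<^sup>2\<close>.
\<close>

section \<open>Holomorphic functions determined by boundary values on a circle\<close>

text \<open>The maximum principle for \<open>f\<close> and for \<open>- f\<close> gives
  \<open>Re f = 0\<close> on the whole ball. The image then lies in the imaginary axis, which
  contains no nonempty open set, so the open mapping theorem makes \<open>f\<close> constant, with
  value \<open>f 0\<close>.\<close>

lemma holomorphic_Re_zero_on_sphere:
  fixes f :: "complex \<Rightarrow> complex"
  assumes f: "f holomorphic_on S" "cball 0 r \<subseteq> S" and r: "r > 0"
    and Re0: "\<And>z. norm z = r \<Longrightarrow> Re (f z) = 0" and f0: "f 0 = 0"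
    and z: "norm z < r"
  shows "f z = 0"
proof -
  have hol: "f holomorphic_on cball 0 r"
    using f by (rule holomorphic_on_subset)
  then have hol': "f holomorphic_on ball 0 r"
    by (rule holomorphic_on_subset) auto
  have cont: "continuous_on (cball 0 r) f"
    using hol by (rule holomorphic_on_imp_continuous_on)
  have Re_le: "Re (g w) \<le> 0" if w: "w \<in> ball 0 r" and g: "g = f \<or> g = (\<lambda>x. - f x)" for g w
  proof (rule maximum_real_frontier[where f = g and S = "ball 0 r" and B = 0])
    show "g holomorphic_on interior (ball 0 r)"
      using g hol' by (auto intro!: holomorphic_intros)
    show "continuous_on (closure (ball 0 r)) g"
      using g cont r by (auto intro!: continuous_intros)
    show "Re (g x) \<le> 0" if "x \<in> frontier (ball 0 r)" for x
      using that g Re0[of x] r by auto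
  qed (use w in auto)
  have Re_eq: "Re (f w) = 0" if "w \<in> ball 0 r" for w
    using Re_le[OF that, of f] Re_le[OF that, of "\<lambda>x. - f x"] by auto
  have "f constant_on ball 0 r"
  proof (rule ccontr)
    assume "\<not> f constant_on ball 0 r"
    then have "open (f ` ball 0 r)"
      using hol' by (intro open_mapping_thm[where S = "ball 0 r"]) auto
    moreover have "0 \<in> f ` ball 0 r"
      using f0 r by (auto intro!: image_eqI[of _ _ 0])
    ultimately obtain e where e: "e > 0" "ball 0 e \<subseteq> f ` ball 0 r"
      by (meson open_contains_ball)
    have "complex_of_real (e / 2) \<in> ball 0 e"
      using e by simp
    then obtain w where "w \<in> ball 0 r" "f w = complex_of_real (e / 2)"
      using e by (metis imageE subsetD)
    with Re_eq[of w] e show False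
      by simp
  qed
  with z r f0 show ?thesis
    by (auto simp: constant_on_def)
qed

lemma holomorphic_add_cnj_zero_on_sphere:
  fixes P Q :: "complex \<Rightarrow> complex"
  assumes hol: "P holomorphic_on S" "Q holomorphic_on S" "cball 0 r \<subseteq> S" and r: "r > 0"
    and eq0: "\<And>z. norm z = r \<Longrightarrow> P z + cnj (Q z) = 0" and "P 0 = 0" "Q 0 = 0"
    and z: "norm z < r"
  shows "P z = 0" "Q z = 0"
proof -
  have "P z + Q z = 0"
  proof (rule holomorphic_Re_zero_on_sphere[where f = "\<lambda>z. P z + Q z" and S = S and r = r])
    show "Re (P w + Q w) = 0" if "norm w = r" for w
      using arg_cong[OF eq0[OF that], of Re] by simp
  qed (use assms in \<open>auto intro!: holomorphic_intros\<close>)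
  \<comment> \<open>Since \<open>Re (\<i> * w) = - Im w\<close>, the factor \<open>\<i>\<close>
    turns the vanishing of \<open>Im (P - Q)\<close> on the circle into a statement about real
    parts.\<close>
  moreover have "\<i> * (P z - Q z) = 0"
  proof (rule holomorphic_Re_zero_on_sphere[where f = "\<lambda>z. \<i> * (P z - Q z)" and S = S and r = r])
    show "Re (\<i> * (P w - Q w)) = 0" if "norm w = r" for w
      using arg_cong[OF eq0[OF that], of Im] by simp
  qed (use assms in \<open>auto intro!: holomorphic_intros\<close>)
  ultimately have "P z + Q z = 0" "P z = Q z"
    by auto
  then show "P z = 0" "Q z = 0"
    by auto
qed

section \<open>Uniqueness of the coefficients of a polyharmonic mapping\<close>

text \<open>The sum is a polynomial in \<open>r\<^sup>2\<close>, and squaring is injective on the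
  nonnegative interval between \<open>s\<close> and \<open>t\<close>, so this polynomial has
  infinitely many roots.\<close>

lemma even_polynomial_zero_coeffs:
  fixes c :: "nat \<Rightarrow> complex"
  assumes s: "0 \<le> s" "s < t"
    and eq0: "\<And>r. s < r \<Longrightarrow> r < t \<Longrightarrow> (\<Sum>k=1..p. of_real (r ^ (2 * (k - 1))) * c k) = 0"
    and k: "k \<in> {1..p}"
  shows "c k = 0"
proof -
  \<comment> \<open>The exponents start at \<open>0\<close>, hence the shift
    \<open>k = Suc i\<close>. Since \<open>k\<close> lies in \<open>{1..p}\<close>, the truncated
    difference \<open>p - 1\<close> is a genuine predecessor.\<close>
  have sum_eq: "(\<Sum>i\<le>p - 1. c (Suc i) * of_real (r\<^sup>2) ^ i) = 0" if "s < r" "r < t" for r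
  proof -
    have "(\<Sum>i\<le>p - 1. c (Suc i) * of_real (r\<^sup>2) ^ i)
        = (\<Sum>k=1..p. of_real (r ^ (2 * (k - 1))) * c k)"
      using k by (intro sum.reindex_bij_witness[of _ "\<lambda>k. k - 1" Suc]) (auto simp: power_mult)
    with eq0[OF that] show ?thesis
      by simp
  qed
  have "inj_on (\<lambda>r. complex_of_real (r\<^sup>2)) {s<..<t}"
    using s by (intro inj_onI) (simp del: of_real_power)
  then have "infinite ((\<lambda>r. complex_of_real (r\<^sup>2)) ` {s<..<t})"
    using s by (simp add: finite_image_iff)
  moreover have "(\<lambda>r. complex_of_real (r\<^sup>2)) ` {s<..<t} \<subseteq> {x. (\<Sum>i\<le>p - 1. c (Suc i) * x ^ i) = 0}"
    using sum_eq by auto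
  ultimately have "infinite {x. (\<Sum>i\<le>p - 1. c (Suc i) * x ^ i) = 0}"
    using finite_subset by blast
  then have "\<forall>i\<le>p - 1. c (Suc i) = 0"
    using polyfun_finite_roots[of "\<lambda>i. c (Suc i)" "p - 1"] by blast
  from this[rule_format, of "k - 1"] k show ?thesis
    by auto
qed

lemma polyharmonic_zero:
  fixes h g :: "nat \<Rightarrow> complex \<Rightarrow> complex"
  assumes hol: "\<And>k. k \<in> {1..p} \<Longrightarrow> h k holomorphic_on unit_disc"
      "\<And>k. k \<in> {1..p} \<Longrightarrow> g k holomorphic_on unit_disc"
    and at0: "\<And>k. k \<in> {1..p} \<Longrightarrow> h k 0 = 0" "\<And>k. k \<in> {1..p} \<Longrightarrow> g k 0 = 0"
    and eq0: "\<And>z. z \<in> unit_disc \<Longrightarrow>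
      (\<Sum>k=1..p. of_real (norm z ^ (2 * (k - 1))) * (h k z + cnj (g k z))) = 0"
    and z: "z \<in> unit_disc" and k: "k \<in> {1..p}"
  shows "h k z = 0" "g k z = 0"
proof -
  \<comment> \<open>The factor \<open>norm w\<close> is replaced by a parameter \<open>r\<close>
    independent of \<open>w\<close>; this makes \<open>P r\<close> and \<open>Q r\<close>
    holomorphic and changes nothing on the circle of radius \<open>r\<close>.\<close>
  define P where "P r w = (\<Sum>k=1..p. of_real (r ^ (2 * (k - 1))) * h k w)" for r w
  define Q where "Q r w = (\<Sum>k=1..p. of_real (r ^ (2 * (k - 1))) * g k w)" for r w
  have PQ: "P r z = 0 \<and> Q r z = 0" if r: "norm z < r" "r < 1" for r
  proof -
    have "P r w + cnj (Q r w) = 0" if "norm w = r" for w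
      using eq0[of w] that r by (simp add: P_def Q_def sum.distrib algebra_simps)
    moreover have "P r holomorphic_on unit_disc" "Q r holomorphic_on unit_disc"
      unfolding P_def Q_def by (auto intro!: holomorphic_intros hol)
    moreover have "P r 0 = 0" "Q r 0 = 0"
      by (simp_all add: P_def Q_def at0)
    moreover have "cball 0 r \<subseteq> unit_disc" "0 < r"
      using r norm_ge_zero[of z] by (auto simp del: norm_ge_zero)
    ultimately show ?thesis
      using r by (blast intro: holomorphic_add_cnj_zero_on_sphere)
  qed
  show "h k z = 0"
    using PQ z k by (intro even_polynomial_zero_coeffs[of "norm z" 1 "\<lambda>k. h k z" p]) (auto simp: P_def)
  show "g k z = 0"
    using PQ z k by (intro even_polynomial_zero_coeffs[of "norm z" 1 "\<lambda>k. g k z" p]) (auto simp: Q_def)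
qed

lemma power_series_zero_coeffs:
  fixes c :: "nat \<Rightarrow> complex"
  assumes c: "\<And>z. z \<in> unit_disc \<Longrightarrow> ((\<lambda>j. c j * z ^ j) has_sum 0) {1..}" and j: "j \<ge> 1"
  shows "c j = 0"
proof (rule ccontr)
  assume nz: "c j \<noteq> 0"
  \<comment> \<open>The series starts at index \<open>1\<close>; padding with \<open>0\<close> at
    index \<open>0\<close> gives an ordinary power series with sum \<open>0\<close>. A nonzero
    coefficient would make its sum nonzero on a punctured disc around \<open>0\<close>, which is
    absurd.\<close>
  define d where "d = (\<lambda>j. if j = 0 then 0 else c j)"
  have "(\<lambda>j. d j * (z - 0) ^ j) sums 0" if "norm (z - 0) < 1" for z
  proof (rule has_sum_imp_sums)
    have "((\<lambda>j. c j * z ^ j) has_sum 0) {1..}"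
      using c that by simp
    also have "?this \<longleftrightarrow> ((\<lambda>j. d j * (z - 0) ^ j) has_sum 0) UNIV"
      by (rule has_sum_cong_neutral) (auto simp: d_def)
    finally show "((\<lambda>j. d j * (z - 0) ^ j) has_sum 0) UNIV" .
  qed
  then obtain s where s: "s > 0" "\<And>z::complex. z \<in> cball 0 s - {0} \<Longrightarrow> (0::complex) \<noteq> 0"
    using nz j powser_0_nonzero[of 1 0 d "\<lambda>_. 0" j] by (auto simp: d_def)
  have "complex_of_real s \<in> cball 0 s - {0}"
    using s(1) by simp
  from s(2)[OF this] show False
    by simp
qed

lemma has_sum_diff:
  fixes f g :: "'a \<Rightarrow> 'b :: topological_ab_group_add"
  assumes "(f has_sum x) A" "(g has_sum y) A"
  shows "((\<lambda>i. f i - g i) has_sum (x - y)) A"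
  using has_sum_add[of f A x "\<lambda>i. - g i" "- y"] assms by (simp add: has_sum_uminus)

text \<open>Membership in \<open>HC_class\<close> provides the inequalities only for some
  coefficient families of \<open>F\<close>; uniqueness carries the bound over to every
  representation.\<close>

lemma polyharmonic_coeffs_unique:
  assumes "polyharmonic_coeffs p F a b" "polyharmonic_coeffs p F a' b'"
    and k: "k \<in> {1..p}" and j: "j \<ge> 1"
  shows "a k j = a' k j" "b k j = b' k j"
proof -
  obtain h g where hg:
    "\<And>k. k \<in> {1..p} \<Longrightarrow> h k holomorphic_on unit_disc"
    "\<And>k. k \<in> {1..p} \<Longrightarrow> g k holomorphic_on unit_disc"
    "\<And>k z. k \<in> {1..p} \<Longrightarrow> z \<in> unit_disc \<Longrightarrow> ((\<lambda>j. a k j * z ^ j) has_sum h k z) {1..}"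
    "\<And>k z. k \<in> {1..p} \<Longrightarrow> z \<in> unit_disc \<Longrightarrow> ((\<lambda>j. b k j * z ^ j) has_sum g k z) {1..}"
    "\<And>z. z \<in> unit_disc \<Longrightarrow>
      F z = (\<Sum>k=1..p. of_real (norm z ^ (2 * (k - 1))) * (h k z + cnj (g k z)))"
    using assms(1) unfolding polyharmonic_coeffs_def by blast
  obtain h' g' where hg':
    "\<And>k. k \<in> {1..p} \<Longrightarrow> h' k holomorphic_on unit_disc"
    "\<And>k. k \<in> {1..p} \<Longrightarrow> g' k holomorphic_on unit_disc"
    "\<And>k z. k \<in> {1..p} \<Longrightarrow> z \<in> unit_disc \<Longrightarrow> ((\<lambda>j. a' k j * z ^ j) has_sum h' k z) {1..}"
    "\<And>k z. k \<in> {1..p} \<Longrightarrow> z \<in> unit_disc \<Longrightarrow> ((\<lambda>j. b' k j * z ^ j) has_sum g' k z) {1..}"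
    "\<And>z. z \<in> unit_disc \<Longrightarrow>
      F z = (\<Sum>k=1..p. of_real (norm z ^ (2 * (k - 1))) * (h' k z + cnj (g' k z)))"
    using assms(2) unfolding polyharmonic_coeffs_def by blast
  have diff: "((\<lambda>j. (a k j - a' k j) * z ^ j) has_sum (h k z - h' k z)) {1..}"
    "((\<lambda>j. (b k j - b' k j) * z ^ j) has_sum (g k z - g' k z)) {1..}"
    if "k \<in> {1..p}" "z \<in> unit_disc" for k z
    unfolding left_diff_distrib
    using has_sum_diff[OF hg(3) hg'(3)] has_sum_diff[OF hg(4) hg'(4)] that by blast+
  \<comment> \<open>All indices are at least \<open>1\<close>, so every term vanishes at the origin.
    This supplies the normalisation at \<open>0\<close> required by
    \<open>polyharmonic_zero\<close>.\<close>
  have sum0: "S = 0" if "((\<lambda>j. c j * 0 ^ j) has_sum S) {1..}" for c :: "nat \<Rightarrow> complex" and S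
    using that has_sum_0[of "{1..}" "\<lambda>j. c j * 0 ^ j"] has_sum_unique by fastforce
  have zero: "h k z - h' k z = 0" "g k z - g' k z = 0" if z: "z \<in> unit_disc" for z
  proof -
    have "(\<Sum>k=1..p. of_real (norm w ^ (2 * (k - 1))) * ((h k w - h' k w) + cnj (g k w - g' k w))) = 0"
      if "w \<in> unit_disc" for w
      using hg(5)[OF that] hg'(5)[OF that] by (simp add: algebra_simps sum.distrib sum_subtractf)
    moreover have "h k 0 - h' k 0 = 0" "g k 0 - g' k 0 = 0" if "k \<in> {1..p}" for k
      using sum0[OF diff(1)[OF that, of 0]] sum0[OF diff(2)[OF that, of 0]] by simp_all
    moreover have "(\<lambda>z. h k z - h' k z) holomorphic_on unit_disc"
      "(\<lambda>z. g k z - g' k z) holomorphic_on unit_disc" if "k \<in> {1..p}" for k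
      using that by (auto intro!: holomorphic_on_diff hg hg')
    ultimately show "h k z - h' k z = 0" "g k z - g' k z = 0"
      using z k polyharmonic_zero[of p "\<lambda>k z. h k z - h' k z" "\<lambda>k z. g k z - g' k z" z k]
      by blast+
  qed
  have "a k j - a' k j = 0"
    using diff(1)[OF k] zero(1) j by (intro power_series_zero_coeffs[of "\<lambda>j. a k j - a' k j"]) auto
  moreover have "b k j - b' k j = 0"
    using diff(2)[OF k] zero(2) j by (intro power_series_zero_coeffs[of "\<lambda>j. b k j - b' k j"]) auto
  ultimately show "a k j = a' k j" "b k j = b' k j"
    by auto
qed

section \<open>The coefficient bound and its sharpness\<close>

lemma HC_class_coeff_bound:
  assumes F: "F \<in> HC_class p" and ab: "polyharmonic_coeffs p F a b" and j: "j \<ge> 2"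
  shows "(\<Sum>k=1..p. norm (a k j) + norm (b k j)) \<le> 1 / real j ^ 2"
proof -
  define f where "f a b k j = (2 * (real k - 1) + real j ^ 2) * (norm (a k j) + norm (b k j))"
    for a b :: "nat \<Rightarrow> nat \<Rightarrow> complex" and k j
  obtain a' b' where ab': "polyharmonic_coeffs p F a' b'"
    and summable: "\<And>k. k \<in> {1..p} \<Longrightarrow> f a' b' k summable_on {2..}"
    and le: "(\<Sum>k=1..p. \<Sum>\<^sub>\<infinity>j\<in>{2..}. f a' b' k j)
      \<le> 1 - norm (b' 1 1) - (\<Sum>k=2..p. (2 * real k - 1) * (norm (a' k 1) + norm (b' k 1)))"
    and nonneg: "0 \<le> norm (b' 1 1) + (\<Sum>k=2..p. (2 * real k - 1) * (norm (a' k 1) + norm (b' k 1)))"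
    using F unfolding HC_class_def f_def[abs_def] by blast
  have "real j ^ 2 * (\<Sum>k=1..p. norm (a k j) + norm (b k j))
      = (\<Sum>k=1..p. real j ^ 2 * (norm (a' k j) + norm (b' k j)))"
    unfolding sum_distrib_left using polyharmonic_coeffs_unique[OF ab ab'] j
    by (intro sum.cong) auto
  also have "\<dots> \<le> (\<Sum>k=1..p. f a' b' k j)"
    unfolding f_def by (intro sum_mono mult_right_mono) auto
  \<comment> \<open>A single term of a summable nonnegative family is at most its sum.\<close>
  also have "\<dots> \<le> (\<Sum>k=1..p. \<Sum>\<^sub>\<infinity>j\<in>{2..}. f a' b' k j)"
  proof (rule sum_mono)
    fix k assume k: "k \<in> {1..p}"
    then have "sum (f a' b' k) {j} \<le> infsum (f a' b' k) {2..}"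
      using j by (intro finite_sum_le_infsum summable) (auto simp: f_def)
    then show "f a' b' k j \<le> (\<Sum>\<^sub>\<infinity>j\<in>{2..}. f a' b' k j)"
      by simp
  qed
  also have "\<dots> \<le> 1"
    using le nonneg by linarith
  finally show ?thesis
    using j by (simp add: field_simps)
qed

lemma HC_class_coeff_bound_sharp:
  assumes p: "p \<ge> 1" and j: "j \<ge> 2"
  shows "\<exists>F\<in>HC_class p. \<exists>a b. polyharmonic_coeffs p F a b \<and>
    (\<Sum>k=1..p. norm (a k j) + norm (b k j)) = 1 / real j ^ 2"
proof -
  define F where "F z = z + z ^ j / of_nat j ^ 2" for z :: complex
  define a :: "nat \<Rightarrow> nat \<Rightarrow> complex" where
    "a k i = (if k = 1 then if i = 1 then 1 else if i = j then 1 / of_nat j ^ 2 else 0 else 0)" for k i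
  define b :: "nat \<Rightarrow> nat \<Rightarrow> complex" where "b k i = 0" for k i
  \<comment> \<open>The extremal map lives entirely in the layer \<open>k = 1\<close>, where the
    factor \<open>norm z ^ (2 * (k - 1))\<close> is \<open>1\<close>.\<close>
  define h where "h k = (if k = 1 then F else (\<lambda>_. 0))" for k :: nat
  have "h k holomorphic_on unit_disc" for k
    unfolding h_def F_def by (auto intro!: holomorphic_intros)
  moreover have "((\<lambda>i. a k i * z ^ i) has_sum h k z) {1..}" for k z
    using j by (intro has_sum_finite_neutralI[of "{1, j}"]) (auto simp: a_def h_def F_def)
  moreover have "((\<lambda>i. b k i * z ^ i) has_sum 0) {1..}" for k z
    by (simp add: b_def)
  moreover have "F z = (\<Sum>k=1..p. of_real (norm z ^ (2 * (k - 1))) * (h k z + cnj 0))" for z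
  proof -
    have "(\<Sum>k=1..p. of_real (norm z ^ (2 * (k - 1))) * (h k z + cnj 0)) = (\<Sum>k\<in>{1}. h k z)"
      using p by (intro sum.mono_neutral_cong_right) (auto simp: h_def)
    then show ?thesis
      by (simp add: h_def)
  qed
  ultimately have coeffs: "polyharmonic_coeffs p F a b"
    unfolding polyharmonic_coeffs_def
    by (intro conjI exI[of _ h] exI[of _ "\<lambda>_ _. 0"]) (auto simp: a_def b_def)
  have sum_coeff: "(\<Sum>k=1..p. norm (a k j) + norm (b k j)) = 1 / real j ^ 2"
  proof -
    have "(\<Sum>k=1..p. norm (a k j) + norm (b k j)) = (\<Sum>k\<in>{1::nat}. 1 / real j ^ 2)"
      using p j by (intro sum.mono_neutral_cong_right)
        (auto simp: a_def b_def norm_divide norm_power)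
    then show ?thesis
      by simp
  qed
  \<comment> \<open>For \<open>k = 1\<close> the weight at \<open>j\<close> is exactly
    \<open>j\<^sup>2\<close>, cancelling the coefficient \<open>1 / j\<^sup>2\<close>. The total is
    \<open>1\<close>, so the inequality defining \<open>HC_class\<close> holds with
    equality.\<close>
  have series: "((\<lambda>i. (2 * (real k - 1) + real i ^ 2) * (norm (a k i) + norm (b k i)))
      has_sum (if k = 1 then 1 else 0)) {2..}" for k
    using j by (intro has_sum_finite_neutralI[of "{j}"])
      (auto simp: a_def b_def norm_divide norm_power)
  have sum_k1: "(\<Sum>k=2..p. (2 * real k - 1) * (norm (a k 1) + norm (b k 1))) = 0"
    by (intro sum.neutral) (auto simp: a_def b_def)
  have "(\<Sum>k=1..p. \<Sum>\<^sub>\<infinity>i\<in>{2..}. (2 * (real k - 1) + real i ^ 2) * (norm (a k i) + norm (b k i))) = 1"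
    using p by (simp only: infsumI[OF series]) simp
  moreover have "(\<lambda>i. (2 * (real k - 1) + real i ^ 2) * (norm (a k i) + norm (b k i))) summable_on {2..}" for k
    using series by (rule has_sum_imp_summable)
  moreover have "b 1 1 = 0"
    by (simp add: b_def)
  ultimately have "F \<in> HC_class p"
    unfolding HC_class_def H_class_def using coeffs sum_k1
    by (intro CollectI conjI exI[of _ a] exI[of _ b] ballI) simp_all
  with coeffs sum_coeff show ?thesis
    by blast
qed

theorem theorem6:
  fixes p :: nat
  assumes "p \<ge> 1"
  shows "(\<forall>F\<in>HC_class p. \<forall>a b. polyharmonic_coeffs p F a b \<longrightarrow>
            (\<forall>j\<ge>2. (\<Sum>k=1..p. norm (a k j) + norm (b k j)) \<le> 1 / real j ^ 2)) \<and>
         (\<forall>j\<ge>2. \<exists>F\<in>HC_class p. \<exists>a b. polyharmonic_coeffs p F a b \<and>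
            (\<Sum>k=1..p. norm (a k j) + norm (b k j)) = 1 / real j ^ 2)"
  using HC_class_coeff_bound HC_class_coeff_bound_sharp[OF assms] by blast

end
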